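(* Let $\mathbb{P}$ be an $\omega$-poset, let $\mathbb{Q}$ be a regular poset and let $\rho\subseteq\mathbb{Q}\times\mathbb{P}$ be a $\wedge$-preserving refiner. Then \[\phi_\rho(S)=\{q\in\mathbb{Q}:\exists p\in S\ \exists q'\in\mathbb{Q}\ (q'\,\rho\,p\text{ and }q'\vartriangleleft q)\}\] defines a continuous map $\phi_\rho:\mathsf{S}\mathbb{P}\to\mathsf{S}\mathbb{Q}$. If moreover $\mathbb{Q}$ and $\mathbb{R}$ are regular $\omega$-posets and $\sigma\subseteq\mathbb{R}\times\mathbb{Q}$ is another $\wedge$-preserving refiner, then \[\phi_\sigma\circ\phi_\rho=\phi_{\sigma\circ\rho},\] where $\sigma\circ\rho=\{(r,p)\in\mathbb{R}\times\mathbb{P}:\exists q\in\mathbb{Q}\ (r\,\sigma\,q\text{ and }q\,\rho\,p)\}$.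
   Context: Let $(\mathbb{P},\leq)$ be a poset. A subset $S\subseteq\mathbb{P}$ refines $T\subseteq\mathbb{P}$ if for every $s\in S$ there is $t\in T$ with $s\leq t$. A band of $\mathbb{P}$ is a finite subset $B\subseteq\mathbb{P}$ such that every $p\in\mathbb{P}$ is comparable to some $b\in B$. A cap of $\mathbb{P}$ is a subset refined by some band. A selector is a subset $S\subseteq\mathbb{P}$ with $S\cap C\neq\emptyset$ for every cap $C$ of $\mathbb{P}$; a minimal selector is one minimal with respect to inclusion among all selectors. The spectrum $\mathsf{S}\mathbb{P}$ is the set of all minimal selectors, with the topology generated by the subbasis consisting of the sets $p^\in=\{S\in\mathsf{S}\mathbb{P}:p\in S\}$, for $p\in\mathbb{P}$. $\mathbb{P}$ is an $\omega$-poset if every principal filter $p^\leq=\{q\in\mathbb{P}:p\leq q\}$ is finite and, for each $n\in\omega$, the number of principal filters of size $n$ is finite. For $p,q\in\mathbb{P}$ write $p\wedge q$ if there is $r\in\mathbb{P}$ with $r\leq p$ and $r\leq q$. For $p\in\mathbb{P}$ and a cap $C$, the star of $p$ in $C$ is $Cp=\{c\in C:c\wedge p\}$. Write $p\vartriangleleft q$ if there is a cap $C$ of $\mathbb{P}$ such that $c\leq q$ for all $c\in Cp$. The poset $\mathbb{P}$ is regular if for every cap $D$ of $\mathbb{P}$ there is a cap $C$ of $\mathbb{P}$ such that for each $c\in C$ there is $d\in D$ with $c\vartriangleleft d$. A relation $\rho\subseteq\mathbb{Q}\times\mathbb{P}$ between posets is a refiner if for every cap $D$ of $\mathbb{Q}$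 there is a cap $C$ of $\mathbb{P}$ such that for every $c\in C$ there is $d\in D$ with $d\,\rho\,c$. It is $\wedge$-preserving if, for all $p,p'\in\mathbb{P}$ and $q,q'\in\mathbb{Q}$, $q\,\rho\,p$, $q'\,\rho\,p'$ and $p\wedge p'$ imply $q\wedge q'$. *)

theory Defs
  imports "HOL-Analysis.Analysis"
begin

text \<open>
  A poset is a carrier set \<open>P\<close> with a relation \<open>le\<close> such that \<^term>\<open>partial_order_on P le\<close>.
  The carrier is explicit (rather than a type of class \<^class>\<open>order\<close>) so that the empty poset is
  included.
\<close>

definition refines :: "'a rel \<Rightarrow> 'a set \<Rightarrow> 'a set \<Rightarrow> bool" where
  "refines le S T \<longleftrightarrow> (\<forall>s\<in>S. \<exists>t\<in>T. (s, t) \<in> le)"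

definition band :: "'a set \<Rightarrow> 'a rel \<Rightarrow> 'a set \<Rightarrow> bool" where
  "band P le B \<longleftrightarrow> finite B \<and> B \<subseteq> P \<and> (\<forall>p\<in>P. \<exists>b\<in>B. (p, b) \<in> le \<or> (b, p) \<in> le)"

definition cap :: "'a set \<Rightarrow> 'a rel \<Rightarrow> 'a set \<Rightarrow> bool" where
  "cap P le C \<longleftrightarrow> C \<subseteq> P \<and> (\<exists>B. band P le B \<and> refines le B C)"

definition selector :: "'a set \<Rightarrow> 'a rel \<Rightarrow> 'a set \<Rightarrow> bool" where
  "selector P le S \<longleftrightarrow> S \<subseteq> P \<and> (\<forall>C. cap P le C \<longrightarrow> S \<inter> C \<noteq> {})"

definition minimal_selector :: "'a set \<Rightarrow> 'a rel \<Rightarrow> 'a set \<Rightarrow> bool" where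
  "minimal_selector P le S \<longleftrightarrow>
     selector P le S \<and> (\<forall>T. selector P le T \<and> T \<subseteq> S \<longrightarrow> T = S)"

definition spectrum :: "'a set \<Rightarrow> 'a rel \<Rightarrow> 'a set set" where
  "spectrum P le = {S. minimal_selector P le S}"

definition subbasic :: "'a set \<Rightarrow> 'a rel \<Rightarrow> 'a \<Rightarrow> 'a set set" where
  "subbasic P le p = {S \<in> spectrum P le. p \<in> S}"

text \<open>
  The whole spectrum is inserted as the empty intersection of subbasic sets, because
  \<^const>\<open>topology_generated_by\<close> only takes nonempty intersections. This matters only for a poset
  without bands: its only minimal selector is the empty set, which lies in no subbasic set.
\<close>

definition spectrum_topology :: "'a set \<Rightarrow> 'a rel \<Rightarrow> 'a set topology" where
  "spectrum_topology P le =
     topology_generated_by (insert (spectrum P le) (subbasic P le ` P))"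

definition principal_filter :: "'a set \<Rightarrow> 'a rel \<Rightarrow> 'a \<Rightarrow> 'a set" where
  "principal_filter P le p = {q \<in> P. (p, q) \<in> le}"

definition omega_poset :: "'a set \<Rightarrow> 'a rel \<Rightarrow> bool" where
  "omega_poset P le \<longleftrightarrow>
     partial_order_on P le \<and>
     (\<forall>p\<in>P. finite (principal_filter P le p)) \<and>
     (\<forall>n::nat. finite {F \<in> principal_filter P le ` P. card F = n})"

text \<open>The relation written \<open>p \<and> q\<close> in the literature; it does not assert that a meet exists.\<close>

definition compatible :: "'a set \<Rightarrow> 'a rel \<Rightarrow> 'a \<Rightarrow> 'a \<Rightarrow> bool" where
  "compatible P le p q \<longleftrightarrow> (\<exists>r\<in>P. (r, p) \<in> le \<and> (r, q) \<in> le)"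

definition star :: "'a set \<Rightarrow> 'a rel \<Rightarrow> 'a set \<Rightarrow> 'a \<Rightarrow> 'a set" where
  "star P le C p = {c \<in> C. compatible P le c p}"

definition star_below :: "'a set \<Rightarrow> 'a rel \<Rightarrow> 'a \<Rightarrow> 'a \<Rightarrow> bool" where
  "star_below P le p q \<longleftrightarrow> (\<exists>C. cap P le C \<and> (\<forall>c\<in>star P le C p. (c, q) \<in> le))"

definition regular_poset :: "'a set \<Rightarrow> 'a rel \<Rightarrow> bool" where
  "regular_poset P le \<longleftrightarrow>
     partial_order_on P le \<and>
     (\<forall>D. cap P le D \<longrightarrow> (\<exists>C. cap P le C \<and> (\<forall>c\<in>C. \<exists>d\<in>D. star_below P le c d)))"

text \<open>
  In \<^term>\<open>refiner Q leQ P leP \<rho>\<close> and \<^term>\<open>meet_preserving Q leQ P leP \<rho>\<close> the relation \<open>\<rho>\<close> is a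
  subset of \<open>Q \<times> P\<close>, although it induces a map from the spectrum of \<open>P\<close> to that of \<open>Q\<close>.
\<close>

definition refiner :: "'b set \<Rightarrow> 'b rel \<Rightarrow> 'a set \<Rightarrow> 'a rel \<Rightarrow> ('b \<times> 'a) set \<Rightarrow> bool" where
  "refiner Q leQ P leP \<rho> \<longleftrightarrow>
     \<rho> \<subseteq> Q \<times> P \<and>
     (\<forall>D. cap Q leQ D \<longrightarrow> (\<exists>C. cap P leP C \<and> (\<forall>c\<in>C. \<exists>d\<in>D. (d, c) \<in> \<rho>)))"

definition meet_preserving :: "'b set \<Rightarrow> 'b rel \<Rightarrow> 'a set \<Rightarrow> 'a rel \<Rightarrow> ('b \<times> 'a) set \<Rightarrow> bool" where
  "meet_preserving Q leQ P leP \<rho> \<longleftrightarrow>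
     (\<forall>p\<in>P. \<forall>p'\<in>P. \<forall>q\<in>Q. \<forall>q'\<in>Q.
        (q, p) \<in> \<rho> \<and> (q', p') \<in> \<rho> \<and> compatible P leP p p' \<longrightarrow> compatible Q leQ q q')"

definition spectrum_map :: "'b set \<Rightarrow> 'b rel \<Rightarrow> ('b \<times> 'a) set \<Rightarrow> 'a set \<Rightarrow> 'b set" where
  "spectrum_map Q leQ \<rho> S =
     {q \<in> Q. \<exists>p\<in>S. \<exists>q'\<in>Q. (q', p) \<in> \<rho> \<and> star_below Q leQ q' q}"

end

theory Submission
  imports Defs
begin

text \<open>
  The proof rests on two facts.

  Elements of a minimal selector \<open>S\<close> of an \<open>\<omega>\<close>-poset are pairwise compatible
  (\<open>minimal_selector_compatible\<close>). By minimality, each \<open>s \<in> S\<close> is the only element of \<open>S\<close> in some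
  cap, and \<open>S\<close> is upward closed. In an \<open>\<omega>\<close>-poset two caps are refined by a common band; an element
  of \<open>S\<close> in a band refining the caps that isolate \<open>s\<close> and \<open>t\<close> lies below both \<open>s\<close> and \<open>t\<close>. The
  common band is a ``level'' below a finite set, built in \<open>omega_poset_low_band\<close>.

  That a selector of \<open>Q\<close> contains a given set can be tested on elements star-below their members
  (\<open>subset_selectorI\<close>). If \<open>q' \<lhd> q\<close> then some cap consists of \<open>q\<close> and of elements incompatible with
  \<open>q'\<close>. A selector must meet this cap, so it contains \<open>q\<close> as soon as its elements all have something
  star-below them that is compatible with \<open>q'\<close>.

  Members of the image \<open>\<phi>\<^bsub>\<rho>\<^esub>(S)\<close> arise from elements \<open>q'\<close> related to members of \<open>S\<close>. These are pairwise
  compatible because \<open>S\<close> is linked and \<open>\<rho>\<close> preserves compatibility. Hence the test applies to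
  \<open>\<phi>\<^bsub>\<rho>\<^esub>(S)\<close> and any selector inside it, which yields minimality. It also applies to
  \<open>\<phi>\<^bsub>\<sigma>\<^esub>(\<phi>\<^bsub>\<rho>\<^esub>(S))\<close> and \<open>\<phi>\<^bsub>\<sigma>\<rho>\<^esub>(S)\<close>; both being minimal selectors, the inclusion so obtained is
  an equality.
\<close>

section \<open>Posets, caps and minimal selectors\<close>

lemma partial_order_on_refl: "partial_order_on P le \<Longrightarrow> p \<in> P \<Longrightarrow> (p, p) \<in> le"
  using partial_order_onD(1) refl_onD by fastforce

lemma partial_order_on_trans:
  "partial_order_on P le \<Longrightarrow> (p, q) \<in> le \<Longrightarrow> (q, r) \<in> le \<Longrightarrow> (p, r) \<in> le"
  by (meson partial_order_onD(2) transD)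

lemma partial_order_on_antisym:
  "partial_order_on P le \<Longrightarrow> (p, q) \<in> le \<Longrightarrow> (q, p) \<in> le \<Longrightarrow> p = q"
  by (meson antisymD partial_order_onD(3))

lemma partial_order_on_carrier:
  "partial_order_on P le \<Longrightarrow> (p, q) \<in> le \<Longrightarrow> p \<in> P \<and> q \<in> P"
  using partial_order_onD(4) by fastforce

lemma exists_minimal_below:
  assumes po: "partial_order_on P le" and "finite F" and "p \<in> F" and "F \<subseteq> P"
  shows "\<exists>m\<in>F. (m, p) \<in> le \<and> (\<forall>x\<in>F. (x, m) \<in> le \<longrightarrow> x = m)"
proof -
  let ?A = "{x \<in> F. (x, p) \<in> le}"
  let ?R = "\<lambda>x y. (x, y) \<in> le \<and> x \<noteq> y"
  have fin: "finite ?A" and ne: "?A \<noteq> {}"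
    using assms partial_order_on_refl[OF po] by auto
  have "asymp_on ?A ?R"
    by (intro asymp_onI) (blast dest: partial_order_on_antisym[OF po])
  moreover have "transp_on ?A ?R"
    by (intro transp_onI)
      (blast intro: partial_order_on_trans[OF po] dest: partial_order_on_antisym[OF po])
  ultimately obtain m where "m \<in> ?A" "\<forall>x\<in>?A. x \<noteq> m \<longrightarrow> \<not> ?R x m"
    using Finite_Set.bex_min_element[OF fin _ _ ne] by blast
  then show ?thesis
    using partial_order_on_trans[OF po] by blast
qed

lemma exists_maximal_above:
  assumes po: "partial_order_on P le" and "finite F" and "p \<in> F" and "F \<subseteq> P"
  shows "\<exists>m\<in>F. (p, m) \<in> le \<and> (\<forall>x\<in>F. (m, x) \<in> le \<longrightarrow> x = m)"
  using exists_minimal_below[of P "le\<inverse>" F p] assms by simp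

lemma cap_upward:
  assumes po: "partial_order_on P le" and C: "cap P le C" and D: "D \<subseteq> P" and ref: "refines le C D"
  shows "cap P le D"
  using assms partial_order_on_trans[OF po] unfolding cap_def refines_def by meson

lemma band_imp_cap: "partial_order_on P le \<Longrightarrow> band P le B \<Longrightarrow> cap P le B"
  unfolding cap_def refines_def using partial_order_on_refl[of P le]
  by (metis band_def subsetD)

lemma minimal_selector_isolating_cap:
  assumes S: "minimal_selector P le S" and s: "s \<in> S"
  obtains C where "cap P le C" "S \<inter> C = {s}"
proof -
  have "\<not> selector P le (S - {s})"
    using S s unfolding minimal_selector_def by blast
  then obtain C where C: "cap P le C" "(S - {s}) \<inter> C = {}"
    using S unfolding minimal_selector_def selector_def by blast
  moreover have "S \<inter> C \<noteq> {}"
    using S C unfolding minimal_selector_def selector_def by blast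
  ultimately show ?thesis
    using that[of C] by blast
qed

text \<open>
  Replacing \<open>s\<close> by \<open>t\<close> in a cap that isolates \<open>s\<close> yields a cap, which can meet the selector only
  in \<open>t\<close>.
\<close>

lemma minimal_selector_upward_closed:
  assumes po: "partial_order_on P le" and S: "minimal_selector P le S"
    and s: "s \<in> S" and st: "(s, t) \<in> le"
  shows "t \<in> S"
proof -
  obtain C where C: "cap P le C" "S \<inter> C = {s}"
    using minimal_selector_isolating_cap[OF S s] .
  have "C \<subseteq> P"
    using C(1) by (simp add: cap_def)
  have "cap P le (insert t (C - {s}))"
  proof (rule cap_upward[OF po C(1)])
    show "insert t (C - {s}) \<subseteq> P"
      using \<open>C \<subseteq> P\<close> partial_order_on_carrier[OF po st] by blast
    show "refines le C (insert t (C - {s}))"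
      using st \<open>C \<subseteq> P\<close> partial_order_on_refl[OF po] unfolding refines_def by blast
  qed
  then have "S \<inter> insert t (C - {s}) \<noteq> {}"
    using S unfolding minimal_selector_def selector_def by blast
  then show ?thesis
    using C(2) by blast
qed

section \<open>Common refinements of bands in an \<open>\<omega>\<close>-poset\<close>

lemma omega_poset_finite_bounded_filters:
  assumes "omega_poset P le"
  shows "finite {p \<in> P. card (principal_filter P le p) \<le> n}" (is "finite ?X")
proof (rule finite_imageD)
  have po: "partial_order_on P le"
    using assms by (simp add: omega_poset_def)
  have "principal_filter P le ` ?X
      \<subseteq> (\<Union>k\<le>n. {F \<in> principal_filter P le ` P. card F = k})"
    by auto
  moreover have "finite (\<Union>k\<le>n. {F \<in> principal_filter P le ` P. card F = k})"
    using assms by (simp add: omega_poset_def)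
  ultimately show "finite (principal_filter P le ` ?X)"
    by (rule finite_subset)
  show "inj_on (principal_filter P le) ?X"
  proof (rule inj_onI)
    fix p q assume "p \<in> ?X" "q \<in> ?X" and eq: "principal_filter P le p = principal_filter P le q"
    then have "p \<in> principal_filter P le p" "q \<in> principal_filter P le q"
      using partial_order_on_refl[OF po] by (auto simp: principal_filter_def)
    then have "(q, p) \<in> le" "(p, q) \<in> le"
      using eq by (auto simp: principal_filter_def)
    then show "p = q"
      using partial_order_on_antisym[OF po] by blast
  qed
qed

text \<open>
  Let \<open>F\<close> be the upward closure of \<open>A\<close>. The minimal elements of \<open>F\<close> together with the maximal
  elements of its complement are comparable to everything: a point of \<open>F\<close> is above one of the
  former, a point outside \<open>F\<close> is below one of the latter. The latter are finite in number because
  everything strictly above them lies in the finite set \<open>F\<close>, which bounds the size of their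
  principal filters.
\<close>

lemma omega_poset_low_band:
  assumes om: "omega_poset P le" and A: "finite A" "A \<subseteq> P"
  obtains B where "band P le B" "\<And>a b. a \<in> A \<Longrightarrow> b \<in> B \<Longrightarrow> (a, b) \<in> le \<Longrightarrow> b = a"
proof -
  have po: "partial_order_on P le" and filters: "\<And>p. p \<in> P \<Longrightarrow> finite (principal_filter P le p)"
    using om by (auto simp: omega_poset_def)
  note refl = partial_order_on_refl[OF po] and trans = partial_order_on_trans[OF po]
    and carrier = partial_order_on_carrier[OF po]
  define F where "F = (\<Union>a\<in>A. principal_filter P le a)"
  define Min where "Min = {m \<in> F. \<forall>x\<in>F. (x, m) \<in> le \<longrightarrow> x = m}"
  define Max where "Max = {m \<in> P - F. \<forall>x\<in>P - F. (m, x) \<in> le \<longrightarrow> x = m}"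
  have finF: "finite F"
    unfolding F_def using A filters by auto
  have FP: "F \<subseteq> P" and AF: "A \<subseteq> F"
    unfolding F_def principal_filter_def using A refl by auto
  have upF: "y \<in> F" if "x \<in> F" "(x, y) \<in> le" for x y
    using that trans carrier unfolding F_def principal_filter_def by blast
  have "Max \<subseteq> {p \<in> P. card (principal_filter P le p) \<le> Suc (card F)}"
  proof
    fix m assume m: "m \<in> Max"
    then have "principal_filter P le m \<subseteq> insert m F"
      unfolding Max_def principal_filter_def by blast
    then have "card (principal_filter P le m) \<le> card (insert m F)"
      using finF by (intro card_mono) auto
    also have "\<dots> \<le> Suc (card F)"
      by (rule card_insert_le_m1) simp_all
    finally show "m \<in> {p \<in> P. card (principal_filter P le p) \<le> Suc (card F)}"
      using m by (simp add: Max_def)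
  qed
  then have "finite Max"
    using omega_poset_finite_bounded_filters[OF om] by (rule finite_subset)
  have "band P le (Min \<union> Max)"
    unfolding band_def
  proof (intro conjI ballI)
    show "finite (Min \<union> Max)"
      using \<open>finite Max\<close> finF by (simp add: Min_def)
    show "Min \<union> Max \<subseteq> P"
      using FP by (auto simp: Min_def Max_def)
    fix p assume p: "p \<in> P"
    show "\<exists>b\<in>Min \<union> Max. (p, b) \<in> le \<or> (b, p) \<in> le"
    proof (cases "p \<in> F")
      case True
      then show ?thesis
        using exists_minimal_below[OF po finF True FP] unfolding Min_def by blast
    next
      case False
      let ?G = "principal_filter P le p - F"
      have "finite ?G" "p \<in> ?G" "?G \<subseteq> P"
        using filters[OF p] refl[OF p] p False by (auto simp: principal_filter_def)
      then obtain m where "m \<in> ?G" and "(p, m) \<in> le" and max: "\<forall>x\<in>?G. (m, x) \<in> le \<longrightarrow> x = m"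
        using exists_maximal_above[OF po] by blast
      moreover have "x = m" if "x \<in> P - F" "(m, x) \<in> le" for x
        using that max trans[OF \<open>(p, m) \<in> le\<close>] by (auto simp: principal_filter_def)
      ultimately have "m \<in> Max"
        unfolding Max_def principal_filter_def by blast
      then show ?thesis
        using \<open>(p, m) \<in> le\<close> by blast
    qed
  qed
  moreover have "b = a" if "a \<in> A" "b \<in> Min \<union> Max" "(a, b) \<in> le" for a b
    using that AF upF unfolding Min_def Max_def by blast
  ultimately show ?thesis
    using that by blast
qed

lemma omega_poset_common_refinement:
  assumes om: "omega_poset P le" and C: "cap P le C" and D: "cap P le D"
  obtains B where "band P le B" "refines le B C" "refines le B D"
proof -
  have po: "partial_order_on P le"
    using om by (simp add: omega_poset_def)
  obtain B1 B2 where B1: "band P le B1" "refines le B1 C" and B2: "band P le B2" "refines le B2 D"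
    using C D unfolding cap_def by blast
  have "finite (B1 \<union> B2)" "B1 \<union> B2 \<subseteq> P"
    using B1 B2 by (auto simp: band_def)
  then obtain B where B: "band P le B"
    and low: "\<And>a b. a \<in> B1 \<union> B2 \<Longrightarrow> b \<in> B \<Longrightarrow> (a, b) \<in> le \<Longrightarrow> b = a"
    using omega_poset_low_band[OF om] by metis
  (* An element of the low band is comparable to one of B', but not strictly above it. *)
  have "refines le B B'" if "band P le B'" "B' \<subseteq> B1 \<union> B2" for B'
    unfolding refines_def
  proof
    fix b assume b: "b \<in> B"
    then have "b \<in> P"
      using B by (auto simp: band_def)
    then obtain a where a: "a \<in> B'" "(b, a) \<in> le \<or> (a, b) \<in> le"
      using \<open>band P le B'\<close> by (auto simp: band_def)
    then show "\<exists>t\<in>B'. (b, t) \<in> le"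
      using low[of a b] b that(2) by blast
  qed
  then have "refines le B B1" "refines le B B2"
    using B1 B2 by auto
  then have "refines le B C" "refines le B D"
    using B1 B2 partial_order_on_trans[OF po] unfolding refines_def by meson+
  then show ?thesis
    using that B by blast
qed

text \<open>
  A band refining both a cap that isolates \<open>s\<close> and a cap that isolates \<open>t\<close> contains an element of
  \<open>S\<close>. As \<open>S\<close> is upward closed, the elements of the two caps above it can only be \<open>s\<close> and \<open>t\<close>.
\<close>

lemma minimal_selector_compatible:
  assumes om: "omega_poset P le" and S: "minimal_selector P le S" and s: "s \<in> S" and t: "t \<in> S"
  shows "compatible P le s t"
proof -
  have po: "partial_order_on P le"
    using om by (simp add: omega_poset_def)
  obtain C where C: "cap P le C" "S \<inter> C = {s}"
    using minimal_selector_isolating_cap[OF S s] .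
  obtain D where D: "cap P le D" "S \<inter> D = {t}"
    using minimal_selector_isolating_cap[OF S t] .
  obtain B where B: "band P le B" "refines le B C" "refines le B D"
    using omega_poset_common_refinement[OF om C(1) D(1)] .
  obtain b where b: "b \<in> S" "b \<in> B"
    using band_imp_cap[OF po B(1)] S unfolding minimal_selector_def selector_def by blast
  obtain c d where cd: "c \<in> C" "(b, c) \<in> le" "d \<in> D" "(b, d) \<in> le"
    using B b unfolding refines_def by blast
  then have "c = s" "d = t"
    using minimal_selector_upward_closed[OF po S b(1)] C(2) D(2) by blast+
  then show ?thesis
    using cd partial_order_on_carrier[OF po] unfolding compatible_def by blast
qed

section \<open>The star-below relation\<close>

text \<open>
  The common lower bound \<open>r\<close> of \<open>p\<close> and \<open>x\<close> is comparable to an element of a band refining the cap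
  that witnesses \<open>p \<lhd> q\<close>. The smaller of the two elements lies below \<open>x\<close> and below a member of the
  star of \<open>p\<close>, hence below \<open>q\<close>.
\<close>

lemma star_below_compatible:
  assumes po: "partial_order_on Q le" and below: "star_below Q le p q" and px: "compatible Q le p x"
  shows "compatible Q le q x"
proof -
  note trans = partial_order_on_trans[OF po]
  obtain C where C: "cap Q le C" and star: "\<forall>c\<in>star Q le C p. (c, q) \<in> le"
    using below by (auto simp: star_below_def)
  obtain B where B: "band Q le B" "refines le B C"
    using C by (auto simp: cap_def)
  obtain r where r: "r \<in> Q" "(r, p) \<in> le" "(r, x) \<in> le"
    using px by (auto simp: compatible_def)
  obtain b where b: "b \<in> B" "(r, b) \<in> le \<or> (b, r) \<in> le"
    using B(1) r(1) by (auto simp: band_def)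
  obtain c where c: "c \<in> C" "(b, c) \<in> le"
    using B(2) b(1) by (auto simp: refines_def)
  have "b \<in> Q"
    using B(1) b(1) by (auto simp: band_def)
  then obtain m where m: "m \<in> Q" "(m, r) \<in> le" "(m, b) \<in> le"
    using b(2) r(1) partial_order_on_refl[OF po] by blast
  then have "(m, c) \<in> le" "(m, p) \<in> le" "(m, x) \<in> le"
    using c(2) r trans by blast+
  then have "c \<in> star Q le C p"
    using c(1) m(1) by (auto simp: star_def compatible_def)
  then have "(m, q) \<in> le"
    using star \<open>(m, c) \<in> le\<close> trans by blast
  then show ?thesis
    using m(1) \<open>(m, x) \<in> le\<close> by (auto simp: compatible_def)
qed

lemma compatible_sym: "compatible P le p q \<Longrightarrow> compatible P le q p"
  by (auto simp: compatible_def)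

lemma star_below_separating_cap:
  assumes po: "partial_order_on Q le" and below: "star_below Q le p q" and q: "q \<in> Q"
  obtains D where "cap Q le D" "\<And>d. d \<in> D \<Longrightarrow> compatible Q le d p \<Longrightarrow> d = q"
proof -
  obtain C where C: "cap Q le C" and star: "\<forall>c\<in>star Q le C p. (c, q) \<in> le"
    using below by (auto simp: star_below_def)
  have CQ: "C \<subseteq> Q"
    using C by (simp add: cap_def)
  let ?D = "insert q (C - star Q le C p)"
  have "cap Q le ?D"
  proof (rule cap_upward[OF po C])
    show "?D \<subseteq> Q"
      using CQ q by blast
    show "refines le C ?D"
      using star CQ partial_order_on_refl[OF po] unfolding refines_def by blast
  qed
  moreover have "d = q" if "d \<in> ?D" "compatible Q le d p" for d
    using that by (auto simp: star_def)
  ultimately show ?thesis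
    using that by blast
qed

text \<open>
  If \<open>p \<lhd> x\<close>, then \<open>Y\<close> meets a cap all of whose elements other than \<open>x\<close> are incompatible with \<open>p\<close>.
  Compatibility of \<open>p\<close> with something star-below \<open>y \<in> Y\<close> makes \<open>p\<close> compatible with \<open>y\<close>, so the
  meeting point is \<open>x\<close>.
\<close>

lemma subset_selectorI:
  assumes po: "partial_order_on Q le" and Y: "selector Q le Y" and X: "X \<subseteq> Q"
    and linked: "\<And>x. x \<in> X \<Longrightarrow> \<exists>p. star_below Q le p x \<and>
        (\<forall>y\<in>Y. \<exists>p'. star_below Q le p' y \<and> compatible Q le p' p)"
  shows "X \<subseteq> Y"
proof
  fix x assume x: "x \<in> X"
  obtain p where p: "star_below Q le p x"
    and linked_p: "\<forall>y\<in>Y. \<exists>p'. star_below Q le p' y \<and> compatible Q le p' p"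
    using linked[OF x] by blast
  obtain D where D: "cap Q le D" "\<And>d. d \<in> D \<Longrightarrow> compatible Q le d p \<Longrightarrow> d = x"
    using star_below_separating_cap[OF po p] x X by blast
  obtain y where y: "y \<in> Y" "y \<in> D"
    using Y D(1) unfolding selector_def by blast
  then have "compatible Q le y p"
    using linked_p star_below_compatible[OF po] by blast
  then show "x \<in> Y"
    using D(2) y by blast
qed

section \<open>The map induced by a refiner\<close>

lemma spectrum_map_selector:
  assumes reg: "regular_poset Q leQ" and ref: "refiner Q leQ P leP \<rho>" and S: "selector P leP S"
  shows "selector Q leQ (spectrum_map Q leQ \<rho> S)"
  unfolding selector_def
proof (intro conjI allI impI)
  show "spectrum_map Q leQ \<rho> S \<subseteq> Q"
    by (auto simp: spectrum_map_def)
  fix D assume D: "cap Q leQ D"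
  then obtain C where C: "cap Q leQ C" "\<forall>c\<in>C. \<exists>d\<in>D. star_below Q leQ c d"
    using reg unfolding regular_poset_def by blast
  then obtain E where E: "cap P leP E" "\<forall>e\<in>E. \<exists>c\<in>C. (c, e) \<in> \<rho>"
    using ref unfolding refiner_def by blast
  obtain e where "e \<in> S" "e \<in> E"
    using S E(1) unfolding selector_def by blast
  moreover then obtain c d where "c \<in> C" "(c, e) \<in> \<rho>" "d \<in> D" "star_below Q leQ c d"
    using C(2) E(2) by blast
  moreover have "C \<subseteq> Q" "D \<subseteq> Q"
    using C(1) D by (auto simp: cap_def)
  ultimately show "spectrum_map Q leQ \<rho> S \<inter> D \<noteq> {}"
    unfolding spectrum_map_def by blast
qed

lemma meet_preservingD:
  assumes "refiner Q leQ P leP \<rho>" "meet_preserving Q leQ P leP \<rho>"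
    and "(q, p) \<in> \<rho>" "(q', p') \<in> \<rho>" "compatible P leP p p'"
  shows "compatible Q leQ q q'"
  using assms unfolding refiner_def meet_preserving_def by blast

lemma spectrum_map_minimal_selector:
  assumes om: "omega_poset P leP" and reg: "regular_poset Q leQ"
    and ref: "refiner Q leQ P leP \<rho>" and meet: "meet_preserving Q leQ P leP \<rho>"
    and S: "minimal_selector P leP S"
  shows "minimal_selector Q leQ (spectrum_map Q leQ \<rho> S)"
  unfolding minimal_selector_def
proof (intro conjI allI impI)
  have po: "partial_order_on Q leQ"
    using reg by (simp add: regular_poset_def)
  show "selector Q leQ (spectrum_map Q leQ \<rho> S)"
    using spectrum_map_selector[OF reg ref] S by (simp add: minimal_selector_def)
  fix T assume T: "selector Q leQ T \<and> T \<subseteq> spectrum_map Q leQ \<rho> S"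
  have linked: "compatible Q leQ q' q"
    if "p \<in> S" "(q, p) \<in> \<rho>" "p' \<in> S" "(q', p') \<in> \<rho>" for p q p' q'
    using meet_preservingD[OF ref meet] minimal_selector_compatible[OF om S] that by blast
  have "spectrum_map Q leQ \<rho> S \<subseteq> T"
  proof (rule subset_selectorI[OF po])
    show "selector Q leQ T" "spectrum_map Q leQ \<rho> S \<subseteq> Q"
      using T by (auto simp: spectrum_map_def)
    fix x assume "x \<in> spectrum_map Q leQ \<rho> S"
    then obtain p q where "p \<in> S" "(q, p) \<in> \<rho>" "star_below Q leQ q x"
      by (auto simp: spectrum_map_def)
    moreover have "\<exists>q'. star_below Q leQ q' y \<and> compatible Q leQ q' q" if "y \<in> T" for y
      using T that linked[OF \<open>p \<in> S\<close> \<open>(q, p) \<in> \<rho>\<close>] unfolding spectrum_map_def by blast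
    ultimately show "\<exists>q. star_below Q leQ q x \<and>
        (\<forall>y\<in>T. \<exists>q'. star_below Q leQ q' y \<and> compatible Q leQ q' q)"
      by blast
  qed
  then show "T = spectrum_map Q leQ \<rho> S"
    using T by blast
qed

lemma topspace_spectrum_topology: "topspace (spectrum_topology P le) = spectrum P le"
  by (auto simp: spectrum_topology_def subbasic_def)

lemma openin_subbasic: "p \<in> P \<Longrightarrow> openin (spectrum_topology P le) (subbasic P le p)"
  by (auto simp: spectrum_topology_def intro: topology_generated_by_Basis)

text \<open>
  By its very definition, the preimage of the subbasic set of \<open>q\<close> is a union of subbasic sets.
\<close>

lemma continuous_map_spectrum_map:
  assumes ref: "refiner Q leQ P leP \<rho>"
    and into: "\<And>S. S \<in> spectrum P leP \<Longrightarrow> spectrum_map Q leQ \<rho> S \<in> spectrum Q leQ"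
  shows "continuous_map (spectrum_topology P leP) (spectrum_topology Q leQ) (spectrum_map Q leQ \<rho>)"
    (is "continuous_map ?X _ ?f")
  unfolding spectrum_topology_def[of Q leQ]
proof (rule continuous_on_generated_topo)
  show "?f ` topspace ?X \<subseteq> \<Union> (insert (spectrum Q leQ) (subbasic Q leQ ` Q))"
    using into by (auto simp: topspace_spectrum_topology)
  fix U assume "U \<in> insert (spectrum Q leQ) (subbasic Q leQ ` Q)"
  then consider "U = spectrum Q leQ" | q where "q \<in> Q" "U = subbasic Q leQ q"
    by blast
  then show "openin ?X (?f -` U \<inter> topspace ?X)"
  proof cases
    case 1
    then have "?f -` U \<inter> topspace ?X = topspace ?X"
      using into by (auto simp: topspace_spectrum_topology)
    then show ?thesis
      by simp
  next
    case (2 q)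
    let ?N = "{p \<in> P. \<exists>q'\<in>Q. (q', p) \<in> \<rho> \<and> star_below Q leQ q' q}"
    have "\<rho> \<subseteq> Q \<times> P"
      using ref by (simp add: refiner_def)
    then have "?f -` U \<inter> topspace ?X = (\<Union>p\<in>?N. subbasic P leP p)"
      using 2 into by (fastforce simp: topspace_spectrum_topology subbasic_def spectrum_map_def)
    then show ?thesis
      by (auto intro: openin_subbasic)
  qed
qed

section \<open>Composition of refiners\<close>

lemma refiner_relcomp:
  assumes "refiner R leR Q leQ \<sigma>" and "refiner Q leQ P leP \<rho>"
  shows "refiner R leR P leP (\<sigma> O \<rho>)"
  unfolding refiner_def
proof (intro conjI allI impI)
  show "\<sigma> O \<rho> \<subseteq> R \<times> P"
    using assms unfolding refiner_def by blast
  fix D assume "cap R leR D"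
  then obtain E where E: "cap Q leQ E" "\<forall>e\<in>E. \<exists>d\<in>D. (d, e) \<in> \<sigma>"
    using assms(1) unfolding refiner_def by blast
  then obtain C where "cap P leP C" "\<forall>c\<in>C. \<exists>e\<in>E. (e, c) \<in> \<rho>"
    using assms(2) unfolding refiner_def by blast
  with E show "\<exists>C. cap P leP C \<and> (\<forall>c\<in>C. \<exists>d\<in>D. (d, c) \<in> \<sigma> O \<rho>)"
    by (meson relcomp.relcompI)
qed

lemma meet_preserving_relcomp:
  assumes "refiner R leR Q leQ \<sigma>" "meet_preserving R leR Q leQ \<sigma>"
    and "refiner Q leQ P leP \<rho>" "meet_preserving Q leQ P leP \<rho>"
  shows "meet_preserving R leR P leP (\<sigma> O \<rho>)"
  unfolding meet_preserving_def
  using meet_preservingD[OF assms(1,2)] meet_preservingD[OF assms(3,4)] by blast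

text \<open>
  A member \<open>x\<close> of the left-hand side comes from \<open>p \<in> S\<close>, \<open>q' \<rho> p\<close>, \<open>q' \<lhd> q\<close>, \<open>r \<sigma> q\<close> and \<open>r \<lhd> x\<close>, and a
  member \<open>y\<close> of the right-hand side from \<open>p\<^sub>2 \<in> S\<close>, \<open>q\<^sub>2 \<rho> p\<^sub>2\<close>, \<open>r\<^sub>2 \<sigma> q\<^sub>2\<close> and \<open>r\<^sub>2 \<lhd> y\<close>. Compatibility
  passes from \<open>p, p\<^sub>2\<close> to \<open>q', q\<^sub>2\<close>, then to \<open>q, q\<^sub>2\<close> and finally to \<open>r, r\<^sub>2\<close>.
\<close>

lemma spectrum_map_relcomp:
  assumes omP: "omega_poset P leP" and regQ: "regular_poset Q leQ"
    and refQ: "refiner Q leQ P leP \<rho>" and meetQ: "meet_preserving Q leQ P leP \<rho>"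
    and omQ: "omega_poset Q leQ" and regR: "regular_poset R leR"
    and refR: "refiner R leR Q leQ \<sigma>" and meetR: "meet_preserving R leR Q leQ \<sigma>"
    and S: "minimal_selector P leP S"
  shows "spectrum_map R leR \<sigma> (spectrum_map Q leQ \<rho> S) = spectrum_map R leR (\<sigma> O \<rho>) S"
    (is "?L = ?M")
proof -
  have poQ: "partial_order_on Q leQ" and poR: "partial_order_on R leR"
    using regQ regR by (auto simp: regular_poset_def)
  have "minimal_selector Q leQ (spectrum_map Q leQ \<rho> S)"
    by (rule spectrum_map_minimal_selector[OF omP regQ refQ meetQ S])
  then have L: "selector R leR ?L"
    using spectrum_map_selector[OF regR refR] by (simp add: minimal_selector_def)
  have M: "minimal_selector R leR ?M"
    by (rule spectrum_map_minimal_selector[OF omP regR refiner_relcomp[OF refR refQ]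
          meet_preserving_relcomp[OF refR meetR refQ meetQ] S])
  have "?L \<subseteq> ?M"
  proof (rule subset_selectorI[OF poR])
    show "selector R leR ?M" "?L \<subseteq> R"
      using L M by (auto simp: minimal_selector_def selector_def)
    fix x assume "x \<in> ?L"
    then obtain p q' q r where p: "p \<in> S" "(q', p) \<in> \<rho>" "star_below Q leQ q' q"
      and r: "(r, q) \<in> \<sigma>" "star_below R leR r x"
      unfolding spectrum_map_def by blast
    have "\<exists>r'. star_below R leR r' y \<and> compatible R leR r' r" if y_in: "y \<in> ?M" for y
    proof -
      obtain p2 q2 r2 where y: "p2 \<in> S" "(q2, p2) \<in> \<rho>" "(r2, q2) \<in> \<sigma>" "star_below R leR r2 y"
        using y_in unfolding spectrum_map_def by blast
      have "compatible Q leQ q' q2"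
        using meet_preservingD[OF refQ meetQ p(2) y(2)]
          minimal_selector_compatible[OF omP S p(1) y(1)] by blast
      then have "compatible Q leQ q q2"
        using star_below_compatible[OF poQ p(3)] by blast
      then have "compatible R leR r2 r"
        using meet_preservingD[OF refR meetR y(3) r(1)] compatible_sym by metis
      then show ?thesis
        using y(4) by blast
    qed
    then show "\<exists>r. star_below R leR r x \<and>
        (\<forall>y\<in>?M. \<exists>r'. star_below R leR r' y \<and> compatible R leR r' r)"
      using r(2) by blast
  qed
  then show ?thesis
    using L M by (simp add: minimal_selector_def)
qed

theorem proposition3p3:
  fixes P :: "'p set" and leP :: "'p rel"
    and Q :: "'q set" and leQ :: "'q rel"
    and \<rho> :: "('q \<times> 'p) set"
  assumes "omega_poset P leP"
    and "regular_poset Q leQ"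
    and "refiner Q leQ P leP \<rho>"
    and "meet_preserving Q leQ P leP \<rho>"
  shows "continuous_map (spectrum_topology P leP) (spectrum_topology Q leQ) (spectrum_map Q leQ \<rho>) \<and>
    (\<forall>(R :: 'r set) leR \<sigma>.
       omega_poset Q leQ \<and> regular_poset R leR \<and> omega_poset R leR \<and>
       refiner R leR Q leQ \<sigma> \<and> meet_preserving R leR Q leQ \<sigma> \<longrightarrow>
       (\<forall>S\<in>spectrum P leP.
          (spectrum_map R leR \<sigma> \<circ> spectrum_map Q leQ \<rho>) S = spectrum_map R leR (\<sigma> O \<rho>) S))"
proof (intro conjI allI impI ballI)
  show "continuous_map (spectrum_topology P leP) (spectrum_topology Q leQ) (spectrum_map Q leQ \<rho>)"
    using spectrum_map_minimal_selector[OF assms]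
    by (intro continuous_map_spectrum_map[OF assms(3)]) (simp add: spectrum_def)
next
  fix R :: "'r set" and leR \<sigma> S
  assume "omega_poset Q leQ \<and> regular_poset R leR \<and> omega_poset R leR \<and>
       refiner R leR Q leQ \<sigma> \<and> meet_preserving R leR Q leQ \<sigma>" and "S \<in> spectrum P leP"
  then show "(spectrum_map R leR \<sigma> \<circ> spectrum_map Q leQ \<rho>) S = spectrum_map R leR (\<sigma> O \<rho>) S"
    using spectrum_map_relcomp[OF assms, of R leR \<sigma> S] by (simp add: spectrum_def)
qed

end
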